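(* Let $n \ge 1$ and let $a_1,\dots,a_n,b,m$ be integers. The linear congruence $a_1x_1+\dots+a_nx_n\equiv b \pmod m$ has a solution $(x_1,\dots,x_n)\in\mathbb{Z}^n$ if and only if $\gcd(a_1,\dots,a_n,m)\mid b$.
   Context: For integers $u,v,m$, $u\equiv v\pmod m$ means $m\mid u-v$; the modulus $m=0$ is allowed, in which case $u\equiv v\pmod 0$ means $u=v$. The gcd of integers that are all zero is $0$, and $0\mid b$ means $b=0$. *)

theory Defs
  imports "HOL-Number_Theory.Cong"
begin

end

theory Submission
  imports Defs
begin

text \<open>Let \<open>g\<close> be the gcd of the coefficients and \<open>m\<close>. Since
  \<open>g\<close> divides \<open>m\<close>, a solution modulo \<open>m\<close> is one modulo
  \<open>g\<close>, where the left side vanishes, so \<open>g\<close> divides \<open>b\<close>.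
  Conversely, \<open>bezout_Gcd_int\<close> writes \<open>g\<close> as a combination of the
  coefficients and \<open>m\<close>; multiplying by \<open>b / g\<close> and discarding the multiple
  of \<open>m\<close> gives a solution. If \<open>g = 0\<close>, then \<open>b = 0\<close> and any
  cofactor serves. The lemma itself iterates two-term Bezout over the index set.\<close>

lemma bezout_Gcd_int:
  fixes f :: "'a \<Rightarrow> int" and m :: int
  assumes "finite A"
  shows "\<exists>x c. (\<Sum>i\<in>A. f i * x i) + m * c = Gcd (insert m (f ` A))"
  using assms
proof (induction A rule: finite_induct)
  case empty
  \<comment> \<open>\<open>Gcd\<close> is nonnegative, so here it is the absolute value of
    \<open>m\<close>, and \<open>sgn m\<close> is the coefficient \<open>c\<close>.\<close>
  have "m * sgn m = Gcd (insert m (f ` {}))"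
    by (simp add: abs_sgn)
  then show ?case by auto
next
  case (insert j A)
  let ?g = "Gcd (insert m (f ` A))"
  obtain x c where xc: "(\<Sum>i\<in>A. f i * x i) + m * c = ?g"
    using insert.IH by blast
  obtain u v where uv: "u * f j + v * ?g = gcd (f j) ?g"
    using bezout_int by blast
  \<comment> \<open>The old combination, including its coefficient \<open>c\<close> of
    \<open>m\<close>, is scaled by \<open>v\<close>; the new index gets \<open>u\<close>. There is
    no clash because \<open>j\<close> lies outside \<open>A\<close>.\<close>
  define y where "y = (\<lambda>i. if i = j then u else v * x i)"
  have "(\<Sum>i\<in>A. f i * y i) = v * (\<Sum>i\<in>A. f i * x i)"
    unfolding sum_distrib_left
    using insert.hyps(2) by (intro sum.cong) (auto simp: y_def)
  then have "(\<Sum>i\<in>insert j A. f i * y i) + m * (v * c) = u * f j + v * ?g"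
    unfolding xc [symmetric] using insert.hyps by (simp add: y_def algebra_simps)
  also have "\<dots> = Gcd (insert m (f ` insert j A))"
    unfolding uv image_insert insert_commute [of m "f j"] Gcd_insert [of "f j"] by (rule refl)
  finally show ?case by blast
qed

theorem theorem1:
  fixes n :: nat and a :: "nat \<Rightarrow> int" and b m :: int
  assumes "n \<ge> 1"
  shows "(\<exists>x :: nat \<Rightarrow> int. [(\<Sum>i = 1..n. a i * x i) = b] (mod m))
    \<longleftrightarrow> Gcd (insert m (a ` {1..n})) dvd b"
proof
  let ?g = "Gcd (insert m (a ` {1..n}))"
  assume "\<exists>x :: nat \<Rightarrow> int. [(\<Sum>i = 1..n. a i * x i) = b] (mod m)"
  then obtain x where x: "[(\<Sum>i = 1..n. a i * x i) = b] (mod m)" by blast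
  \<comment> \<open>The congruence descends from \<open>m\<close> to its divisor \<open>?g\<close>,
    also when \<open>m = 0\<close>.\<close>
  have "[(\<Sum>i = 1..n. a i * x i) = b] (mod ?g)"
    by (rule cong_dvd_modulus [OF x]) (rule Gcd_dvd, simp)
  moreover have "?g dvd (\<Sum>i = 1..n. a i * x i)"
    by (intro dvd_sum dvd_mult2 Gcd_dvd) auto
  ultimately show "?g dvd b"
    by (simp add: cong_dvd_iff)
next
  let ?g = "Gcd (insert m (a ` {1..n}))"
  assume "?g dvd b"
  then obtain k where k: "b = ?g * k" by (elim dvdE)
  obtain x c where xc: "(\<Sum>i = 1..n. a i * x i) + m * c = ?g"
    using bezout_Gcd_int [of "{1..n}" a m] by auto
  have "(\<Sum>i = 1..n. a i * (x i * k)) = (\<Sum>i = 1..n. a i * x i) * k"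
    by (simp add: sum_distrib_right mult.assoc)
  \<comment> \<open>Scaled by \<open>k\<close>, the Bezout identity has value \<open>b\<close>; its
    term in \<open>m\<close> is the whole discrepancy.\<close>
  then have "(\<Sum>i = 1..n. a i * (x i * k)) - b = m * (- c * k)"
    unfolding k xc [symmetric] by (simp add: algebra_simps)
  then have "[(\<Sum>i = 1..n. a i * (x i * k)) = b] (mod m)"
    by (simp add: cong_iff_dvd_diff)
  then show "\<exists>x :: nat \<Rightarrow> int. [(\<Sum>i = 1..n. a i * x i) = b] (mod m)"
    by (intro exI)
qed

end
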